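(* Let $\lambda$ be a partition of size $r$ and consider the seminormal representation of the Hecke algebra $H_r(q)$ with basis the standard tableaux of shape $\lambda$. For $1\le i\le r-1$ let $\tau_i$ act as $J_{i-1}^{1/2}\,t_i\,J_i^{-1/2}$. Then for every standard tableau $T$ of shape $\lambda$, with $a=a_T(i)=c_T(i+1)-c_T(i)$ the axial distance, $$\tau_iT=\begin{cases}\dfrac{1}{[a]}\,T+s_iT&\text{if } c_T(i+1)>c_T(i),\\[2mm] \dfrac{1}{[a]}\,T+\dfrac{[a-1][a+1]}{[a]^2}\,s_iT&\text{if } c_T(i)>c_T(i+1).\end{cases}$$
   Context: Quantum integers: $[n]=\dfrac{q^n-q^{-n}}{q-q^{-1}}\in\mathbb Q(q)$ for $n\in\mathbb Z$ (so $[-n]=-[n]$). The Hecke algebra $H_r(q)$ over $\mathbb Q(q)$ has generators $u_1,\dots,u_{r-1}$ and relations $u_i^2=-[2]u_i$, $u_iu_{i+1}u_i-u_i=u_{i+1}u_iu_{i+1}-u_{i+1}$, and $u_iu_j=u_ju_i$ for $|i-j|>1$. Put $t_i=q+u_i$ (so $t_i^{-1}=q^{-1}+u_i$). For a standard tableau $T$ of shape $\lambda$, the content is $c_T(k)=j-i$ if $k$ lies in the box in row $i$, column $j$. $s_iT$ is the tableau obtained from $T$ by interchanging $i$ and $i+1$, with $s_iT=0$ if the result is not standard. The seminormal representation is the $\mathbb Q(q)$-vector space with basis the standard tableaux of shape $\lambda$ and action, with $a=c_T(i+1)-c_T(i)$, $$u_iT=\begin{cases}-\frac{[a-1]}{[a]}T+s_iT&\text{if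 }c_T(i+1)>c_T(i),\\ -\frac{[a-1]}{[a]}T+\frac{[a-1][a+1]}{[a]^2}s_iT&\text{if }c_T(i)>c_T(i+1).\end{cases}$$ The Jucys–Murphy elements are $J_i=(t_i\cdots t_2t_1)(t_1t_2\cdots t_i)$ for $1\le i\le r-1$, and $J_0=1$. They act diagonally: $J_iT=q^{2c_T(i+1)}T$. Their square roots are defined by $J_i^{\pm1/2}T=q^{\pm c_T(i+1)}T$. The operators $\tau_i=J_{i-1}^{1/2}t_iJ_i^{-1/2}$ are the local rules for the coboundary structure (Drinfel'd unitarisation) in the seminormal representation. *)

theory Defs
  imports
    "HOL-Computational_Algebra.Polynomial_Factorial"
    "HOL-Combinatorics.Transposition"
    "HOL-Library.Function_Algebras"
begin

section \<open>The field of rational functions and quantum integers\<close>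

type_synonym ratfun = "rat poly fract"

definition q :: ratfun where
  "q = to_fract [:0, 1:]"

definition qint :: "int \<Rightarrow> ratfun" where
  "qint n = (q powi n - q powi (- n)) / (q - inverse q)"

section \<open>Standard tableaux\<close>

definition partition_of :: "nat list \<Rightarrow> nat \<Rightarrow> bool" where
  "partition_of lam r \<longleftrightarrow> sorted_wrt (\<ge>) lam \<and> 0 \<notin> set lam \<and> sum_list lam = r"

text \<open>Boxes are pairs (row, column), with rows and columns numbered from 0.
  This leaves the contents (column minus row) unchanged.\<close>

definition cells :: "nat list \<Rightarrow> (nat \<times> nat) set" where
  "cells lam = {(i, j). i < length lam \<and> j < lam ! i}"

text \<open>A tableau assigns an entry to each box. It is 0 outside the shape, so that two
  standard tableaux of the same shape are equal as functions iff they are equal as fillings.\<close>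

type_synonym tableau = "nat \<times> nat \<Rightarrow> nat"

definition SYT :: "nat list \<Rightarrow> tableau set" where
  "SYT lam = {T. bij_betw T (cells lam) {1..sum_list lam}
     \<and> (\<forall>p. p \<notin> cells lam \<longrightarrow> T p = 0)
     \<and> (\<forall>i j j'. (i, j) \<in> cells lam \<and> (i, j') \<in> cells lam \<and> j < j' \<longrightarrow> T (i, j) < T (i, j'))
     \<and> (\<forall>i i' j. (i, j) \<in> cells lam \<and> (i', j) \<in> cells lam \<and> i < i' \<longrightarrow> T (i, j) < T (i', j))}"

text \<open>Only meaningful for an entry \<open>k \<ge> 1\<close> that occurs exactly once in \<open>T\<close>.\<close>

definition tab_content :: "tableau \<Rightarrow> nat \<Rightarrow> int" where
  "tab_content T k = (let p = (THE p. T p = k) in int (snd p) - int (fst p))"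

definition axial :: "tableau \<Rightarrow> nat \<Rightarrow> int" where
  "axial T i = tab_content T (i + 1) - tab_content T i"

section \<open>The seminormal representation\<close>

text \<open>The representation space with basis the standard tableaux of shape \<open>lam\<close> consists of the
  functions on tableaux that vanish outside of \<open>SYT lam\<close> (a finite set).\<close>

type_synonym vec = "tableau \<Rightarrow> ratfun"

definition vscale :: "ratfun \<Rightarrow> vec \<Rightarrow> vec" (infixr "\<odot>" 75) where
  "c \<odot> v = (\<lambda>S. c * v S)"

definition seminormal_space :: "nat list \<Rightarrow> vec set" where
  "seminormal_space lam = {v. \<forall>S. S \<notin> SYT lam \<longrightarrow> v S = 0}"

definition basis :: "tableau \<Rightarrow> vec" where
  "basis T = (\<lambda>S. if S = T then 1 else 0)"

definition lin_ext :: "nat list \<Rightarrow> (tableau \<Rightarrow> vec) \<Rightarrow> vec \<Rightarrow> vec" where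
  "lin_ext lam f v = (\<Sum>T\<in>SYT lam. v T \<odot> f T)"

definition tab_swap :: "nat \<Rightarrow> tableau \<Rightarrow> tableau" where
  "tab_swap i T = Transposition.transpose i (i + 1) \<circ> T"

definition s_act :: "nat list \<Rightarrow> nat \<Rightarrow> tableau \<Rightarrow> vec" where
  "s_act lam i T = (if tab_swap i T \<in> SYT lam then basis (tab_swap i T) else 0)"

text \<open>Contents of \<open>i\<close> and \<open>i + 1\<close> in a standard tableau are never equal (see
  \<open>axial_nonzero\<close> below), so the second case is that of a larger content of \<open>i\<close>.\<close>

definition u_op :: "nat list \<Rightarrow> nat \<Rightarrow> vec \<Rightarrow> vec" where
  "u_op lam i = lin_ext lam (\<lambda>T. let a = axial T i in
     if tab_content T (i + 1) > tab_content T i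
     then - (qint (a - 1) / qint a) \<odot> basis T + s_act lam i T
     else - (qint (a - 1) / qint a) \<odot> basis T
            + (qint (a - 1) * qint (a + 1) / (qint a)\<^sup>2) \<odot> s_act lam i T)"

definition t_op :: "nat list \<Rightarrow> nat \<Rightarrow> vec \<Rightarrow> vec" where
  "t_op lam i v = q \<odot> v + u_op lam i v"

text \<open>\<open>JM lam i\<close> is the action of $(t_i \cdots t_1)(t_1 \cdots t_i)$.\<close>

fun t_down :: "nat list \<Rightarrow> nat \<Rightarrow> vec \<Rightarrow> vec" where
  "t_down lam 0 = id"
| "t_down lam (Suc i) = t_op lam (Suc i) \<circ> t_down lam i"

fun t_up :: "nat list \<Rightarrow> nat \<Rightarrow> vec \<Rightarrow> vec" where
  "t_up lam 0 = id"
| "t_up lam (Suc i) = t_up lam i \<circ> t_op lam (Suc i)"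

definition JM :: "nat list \<Rightarrow> nat \<Rightarrow> vec \<Rightarrow> vec" where
  "JM lam i = t_down lam i \<circ> t_up lam i"

definition JM_sqrt :: "nat list \<Rightarrow> nat \<Rightarrow> vec \<Rightarrow> vec" where
  "JM_sqrt lam i = lin_ext lam (\<lambda>T. q powi (tab_content T (i + 1)) \<odot> basis T)"

definition JM_inv_sqrt :: "nat list \<Rightarrow> nat \<Rightarrow> vec \<Rightarrow> vec" where
  "JM_inv_sqrt lam i = lin_ext lam (\<lambda>T. q powi (- tab_content T (i + 1)) \<odot> basis T)"

definition tau :: "nat list \<Rightarrow> nat \<Rightarrow> vec \<Rightarrow> vec" where
  "tau lam i = JM_sqrt lam (i - 1) \<circ> t_op lam i \<circ> JM_inv_sqrt lam i"

text \<open>A representation of the Hecke algebra, given by generators and relations, on a subspace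
  \<open>V\<close> is a family of linear operators preserving \<open>V\<close> and satisfying the relations there.\<close>

definition hecke_rep :: "nat \<Rightarrow> vec set \<Rightarrow> (nat \<Rightarrow> vec \<Rightarrow> vec) \<Rightarrow> bool" where
  "hecke_rep r V U \<longleftrightarrow>
     module.subspace vscale V
   \<and> (\<forall>i\<in>{1..<r}. Vector_Spaces.linear vscale vscale (U i) \<and> U i ` V \<subseteq> V)
   \<and> (\<forall>i\<in>{1..<r}. \<forall>v\<in>V. U i (U i v) = - qint 2 \<odot> U i v)
   \<and> (\<forall>i. 1 \<le> i \<and> i + 1 < r \<longrightarrow> (\<forall>v\<in>V.
        U i (U (i + 1) (U i v)) - U i v = U (i + 1) (U i (U (i + 1) v)) - U (i + 1) v))
   \<and> (\<forall>i\<in>{1..<r}. \<forall>j\<in>{1..<r}. i + 1 < j \<or> j + 1 < i \<longrightarrow> (\<forall>v\<in>V. U i (U j v) = U j (U i v)))"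

section \<open>Adequacy of the definitions\<close>

subsection \<open>Quantum integers\<close>

lemma q_nonzero [simp]: "q \<noteq> 0"
  by (simp add: q_def)

lemma q_power: "q ^ n = to_fract (monom 1 n)"
proof (induction n)
  case (Suc n)
  then show ?case
    by (simp add: q_def monom_Suc flip: to_fract_mult)
qed (simp add: monom_0 flip: one_pCons)

lemma q_power_eq_1: "q ^ n = 1 \<longleftrightarrow> n = 0"
proof -
  have "q ^ n = 1 \<longleftrightarrow> (monom 1 n :: rat poly) = 1"
    by (metis q_power to_fract_1 to_fract_eq_iff)
  also have "\<dots> \<longleftrightarrow> n = 0"
    by (metis degree_1 degree_monom_eq monom_eq_1 one_neq_zero)
  finally show ?thesis .
qed

lemma q_powi_eq_1: "q powi n = 1 \<longleftrightarrow> n = 0"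
  by (auto simp: power_int_def q_power_eq_1 power_inverse)

lemma q_sq: "q * q \<noteq> 1"
  using q_power_eq_1[of 2] by (simp add: power2_eq_square)

lemma q_minus_inv: "q - inverse q \<noteq> 0"
  using q_sq by (auto simp: field_simps)

definition Q :: "int \<Rightarrow> ratfun" where "Q n = q powi n * q powi n"

lemma Q_nonzero [simp]: "Q n \<noteq> 0"
  by (simp add: Q_def)

lemma Q_add: "Q (m + n) = Q m * Q n"
  by (simp add: Q_def power_int_add)

lemma Q_minus: "Q (- n) = inverse (Q n)"
  by (simp add: Q_def power_int_minus)

lemma Q_1: "Q 1 = q * q"
  by (simp add: Q_def)

lemma Q_eq_1: "Q n = 1 \<longleftrightarrow> n = 0"
proof -
  have "Q n = q powi (2 * n)" by (simp add: Q_def flip: power_int_add)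
  thus ?thesis by (simp add: q_powi_eq_1)
qed

lemma qint_0 [simp]: "qint 0 = 0"
  by (simp add: qint_def)

lemma qint_minus: "qint (- n) = - qint n"
  by (simp add: qint_def minus_divide_left)

lemma qint_Q: "qint n = (Q n - 1) / (q powi n * (q - inverse q))"
  by (simp add: qint_def Q_def power_int_minus divide_simps)

lemma qint_nonzero: "n \<noteq> 0 \<Longrightarrow> qint n \<noteq> 0"
  using q_minus_inv by (simp add: qint_Q Q_eq_1)

definition dcoef :: "int \<Rightarrow> ratfun" where
  "dcoef a = - (qint (a - 1) / qint a)"

definition ecoef :: "int \<Rightarrow> ratfun" where
  "ecoef a = (if a > 0 then 1 else qint (a - 1) * qint (a + 1) / (qint a)\<^sup>2)"

lemma dcoef_Q:
  assumes "a \<noteq> 0"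
  shows "dcoef a = (q * q - Q a) / (q * (Q a - 1))"
proof -
  have [simp]: "Q a \<noteq> 1" using assms by (simp add: Q_eq_1)
  have "Q (a - 1) = Q a / (q * q)" using Q_add[of a "-1"] by (simp add: Q_minus Q_1 field_simps)
  moreover have "q powi (a - 1) = q powi a / q" by (simp add: power_int_diff)
  ultimately show ?thesis
    using q_minus_inv by (simp add: dcoef_def qint_Q) (simp add: divide_simps)
qed


lemma braid_id:
  fixes A B z :: "'a::field"
  assumes "A \<noteq> 1" "B \<noteq> 1" "A * B \<noteq> 1" "z \<noteq> 0"
  shows "(z * z - A) / (z * (A - 1)) * ((z * z - B) / (z * (B - 1)))
     + (z * z - A * B) / (z * (A * B - 1)) * ((z * z * A - 1) / (z * (1 - A))) - 1
     = (z * z - B) / (z * (B - 1)) * ((z * z - A * B) / (z * (A * B - 1)))"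
proof -
  define x y w where "x = inverse (A - 1)" and "y = inverse (B - 1)" and "w = inverse (A * B - 1)"
  define z' where "z' = inverse z"
  have e: "x * (A - 1) = 1" "y * (B - 1) = 1" "w * (A * B - 1) = 1" "z' * z = 1"
    using assms by (simp_all add: x_def y_def w_def z'_def)
  have i: "inverse (1 - A) = - x"
    unfolding x_def by (metis minus_diff_eq nonzero_inverse_minus_eq assms(1) right_minus_eq)
  have "(z * z - A) * (z' * x) * ((z * z - B) * (z' * y))
     + (z * z - A * B) * (z' * w) * ((z * z * A - 1) * (z' * - x)) - 1
     = (z * z - B) * (z' * y) * ((z * z - A * B) * (z' * w))"
    using e by algebra
  thus ?thesis
    by (simp add: divide_inverse i flip: x_def y_def w_def z'_def)
qed

lemma minus_id:
  fixes A z :: "'a::field"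
  assumes "A \<noteq> 1" "A \<noteq> 0" "z \<noteq> 0"
  shows "(z * z - inverse A) / (z * (inverse A - 1)) = (z * z * A - 1) / (z * (1 - A))"
  using assms by (simp add: frac_eq_eq) (simp add: field_simps)

lemma sum_id:
  fixes A z :: "'a::field"
  assumes "A \<noteq> 1" "z \<noteq> 0"
  shows "(z * z - A) / (z * (A - 1)) + (z * z * A - 1) / (z * (1 - A)) = - ((z * z + 1) / z)"
proof -
  have "(z * z * A - 1) / (z * (1 - A)) = (1 - z * z * A) / (z * (A - 1))"
    using assms by (simp add: frac_eq_eq) (simp add: algebra_simps)
  hence "(z * z - A) / (z * (A - 1)) + (z * z * A - 1) / (z * (1 - A))
      = ((z * z - A) + (1 - z * z * A)) / (z * (A - 1))"
    by (simp only: add_divide_distrib)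
  also have "(z * z - A) + (1 - z * z * A) = (- (z * z + 1)) * (A - 1)"
    by (simp add: algebra_simps)
  also have "\<dots> / (z * (A - 1)) = - (z * z + 1) / z"
    using assms by (subst nonzero_mult_divide_mult_cancel_right) auto
  finally show ?thesis by (simp only: minus_divide_left)
qed

lemma two_id:
  fixes z :: "'a::field"
  assumes "z \<noteq> 0" "z - inverse z \<noteq> 0"
  shows "(z * z - inverse (z * z)) / (z - inverse z) = (z * z + 1) / z"
proof -
  have "(z * z - inverse (z * z)) = (z + inverse z) * (z - inverse z)"
    by (simp add: algebra_simps)
  thus ?thesis using assms by (simp add: field_simps)
qed
lemma dcoef_minus:
  assumes "a \<noteq> 0"
  shows "dcoef (- a) = (q * q * Q a - 1) / (q * (1 - Q a))"
proof -
  have "Q a \<noteq> 1" using assms by (simp add: Q_eq_1)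
  thus ?thesis
    using minus_id[of "Q a" q] assms by (simp add: dcoef_Q Q_minus)
qed

lemma dcoef_braid:
  assumes "a \<noteq> 0" "b \<noteq> 0" "a + b \<noteq> 0"
  shows "dcoef a * dcoef b + dcoef (a + b) * dcoef (- a) - 1 = dcoef b * dcoef (a + b)"
proof -
  have nz: "Q a \<noteq> 1" "Q b \<noteq> 1" "Q a * Q b \<noteq> 1"
    using assms by (simp_all add: Q_eq_1 flip: Q_add)
  show ?thesis
    unfolding dcoef_minus[OF assms(1)] dcoef_Q[OF assms(1)] dcoef_Q[OF assms(2)]
      dcoef_Q[OF assms(3)] Q_add
    by (rule braid_id[OF nz q_nonzero])
qed

lemma dcoef_sum: 
  assumes "a \<noteq> 0"
  shows "dcoef a + dcoef (- a) = - qint 2"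
proof -
  have "Q a \<noteq> 1" using assms by (simp add: Q_eq_1)
  moreover have "qint 2 = (q * q - inverse (q * q)) / (q - inverse q)"
    by (simp add: qint_def power_int_minus power2_eq_square)
  ultimately show ?thesis
    unfolding dcoef_minus[OF assms] dcoef_Q[OF assms]
    using sum_id[of "Q a" q] two_id[of q] q_minus_inv by simp
qed

lemma dcoef_prod: "dcoef a * dcoef (- a) = qint (a - 1) * qint (a + 1) / (qint a)\<^sup>2"
proof -
  have "qint (- a - 1) = - qint (a + 1)"
    using qint_minus[of "a + 1"] by simp
  thus ?thesis by (simp add: dcoef_def qint_minus power2_eq_square)
qed

lemma dcoef_1 [simp]: "dcoef 1 = 0"
  by (simp add: dcoef_def)

lemma ecoef_prod: "a \<noteq> 0 \<Longrightarrow> ecoef a * ecoef (- a) = dcoef a * dcoef (- a)"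
  using dcoef_prod[of a] dcoef_prod[of "- a"] by (auto simp: ecoef_def mult.commute)

lemma ecoef_prod_1: "\<bar>a\<bar> = 1 \<Longrightarrow> ecoef a * ecoef (- a) = 0"
  using ecoef_prod[of a] by (cases "a = 1") (auto simp: abs_if split: if_splits)

subsection \<open>Tableaux\<close>

lemma finite_cells [simp]: "finite (cells lam)"
proof (rule finite_subset)
  show "cells lam \<subseteq> {..<length lam} \<times> {..<Suc (sum_list lam)}"
    using elem_le_sum_list[of _ lam] by (fastforce simp: cells_def)
qed simp

lemma finite_SYT [simp]: "finite (SYT lam)"
proof (rule finite_subset)
  show "SYT lam \<subseteq> {T. \<forall>p. (p \<in> cells lam \<longrightarrow> T p \<in> {1..sum_list lam}) \<and> (p \<notin> cells lam \<longrightarrow> T p = 0)}"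
    by (auto simp: SYT_def bij_betw_def)
  show "finite \<dots>"
    by (rule finite_set_of_finite_funs) simp_all
qed

text \<open>\<open>before lam T k l\<close>: the entry \<open>k\<close> is to the left of \<open>l\<close> in the same row or above \<open>l\<close> in the
  same column.\<close>

definition before :: "nat list \<Rightarrow> tableau \<Rightarrow> nat \<Rightarrow> nat \<Rightarrow> bool" where
  "before lam T k l \<longleftrightarrow> (\<exists>p\<in>cells lam. \<exists>p'\<in>cells lam. T p = k \<and> T p' = l \<and>
     (fst p = fst p' \<and> snd p < snd p' \<or> snd p = snd p' \<and> fst p < fst p'))"

lemma SYT_before:
  "T \<in> SYT lam \<longleftrightarrow> bij_betw T (cells lam) {1..sum_list lam} \<and> (\<forall>p. p \<notin> cells lam \<longrightarrow> T p = 0)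
     \<and> (\<forall>k l. before lam T k l \<longrightarrow> k < l)"
proof -
  have "(\<forall>k l. before lam T k l \<longrightarrow> k < l) \<longleftrightarrow>
    (\<forall>i j j'. (i, j) \<in> cells lam \<and> (i, j') \<in> cells lam \<and> j < j' \<longrightarrow> T (i, j) < T (i, j'))
     \<and> (\<forall>i i' j. (i, j) \<in> cells lam \<and> (i', j) \<in> cells lam \<and> i < i' \<longrightarrow> T (i, j) < T (i', j))"
    (is "?L = (?R1 \<and> ?R2)")
  proof (intro iffI conjI)
    assume L: ?L
    show ?R1
    proof (intro allI impI)
      fix i j j' assume "(i, j) \<in> cells lam \<and> (i, j') \<in> cells lam \<and> j < j'"
      hence "before lam T (T (i, j)) (T (i, j'))"
        unfolding before_def by (intro bexI[of _ "(i, j)"] bexI[of _ "(i, j')"]) auto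
      thus "T (i, j) < T (i, j')" using L by blast
    qed
    show ?R2
    proof (intro allI impI)
      fix i i' j assume "(i, j) \<in> cells lam \<and> (i', j) \<in> cells lam \<and> i < i'"
      hence "before lam T (T (i, j)) (T (i', j))"
        unfolding before_def by (intro bexI[of _ "(i, j)"] bexI[of _ "(i', j)"]) auto
      thus "T (i, j) < T (i', j)" using L by blast
    qed
  next
    assume R: "?R1 \<and> ?R2"
    show ?L
    proof (intro allI impI)
      fix k l assume "before lam T k l"
      then obtain i j i' j' where "(i, j) \<in> cells lam" "(i', j') \<in> cells lam" "T (i, j) = k"
        "T (i', j') = l" "i = i' \<and> j < j' \<or> j = j' \<and> i < i'"
        unfolding before_def by auto
      thus "k < l" using R by blast
    qed
  qed
  thus ?thesis unfolding SYT_def by blast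
qed

lemma before_less: "T \<in> SYT lam \<Longrightarrow> before lam T k l \<Longrightarrow> k < l"
  by (auto simp: SYT_before)

lemma before_comp: "before lam (f \<circ> T) k l \<longleftrightarrow> (\<exists>k' l'. k = f k' \<and> l = f l' \<and> before lam T k' l')"
  unfolding before_def o_def by blast

lemma SYT_perm:
  assumes "T \<in> SYT lam" "bij_betw f {1..sum_list lam} {1..sum_list lam}" "f 0 = 0"
  shows "f \<circ> T \<in> SYT lam \<longleftrightarrow> (\<forall>k l. before lam T k l \<longrightarrow> f k < f l)"
proof -
  have "bij_betw (f \<circ> T) (cells lam) {1..sum_list lam}"
    using assms by (auto simp: SYT_before intro: bij_betw_trans)
  moreover have "\<forall>p. p \<notin> cells lam \<longrightarrow> (f \<circ> T) p = 0"
    using assms by (auto simp: SYT_before)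
  ultimately show ?thesis
    unfolding SYT_before[of "f \<circ> T"] before_comp by blast
qed

lemma SYT_cell:
  assumes "T \<in> SYT lam" "1 \<le> k" "k \<le> sum_list lam"
  obtains p where "p \<in> cells lam" "T p = k"
proof -
  have "T ` cells lam = {1..sum_list lam}"
    using assms(1) unfolding SYT_before bij_betw_def by blast
  hence "k \<in> T ` cells lam" using assms by simp
  thus ?thesis using that by blast
qed

lemma SYT_range:
  assumes "T \<in> SYT lam" "p \<in> cells lam"
  shows "1 \<le> T p \<and> T p \<le> sum_list lam"
proof -
  have "bij_betw T (cells lam) {1..sum_list lam}" using assms by (simp add: SYT_before)
  from bij_betw_apply[OF this assms(2)] show ?thesis by simp
qed

lemma SYT_inj:
  assumes "T \<in> SYT lam" "p \<in> cells lam" "T p = T p'"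
  shows "p = p'"
proof -
  have "inj_on T (cells lam)" and out: "\<forall>p. p \<notin> cells lam \<longrightarrow> T p = 0"
    using assms(1) unfolding SYT_before bij_betw_def by blast+
  moreover have "p' \<in> cells lam"
    using SYT_range[OF assms(1,2)] out assms(3) by (metis not_one_le_zero)
  ultimately show ?thesis using assms(2,3) by (auto dest: inj_onD)
qed

lemma content_cell:
  assumes "T \<in> SYT lam" "p \<in> cells lam" "T p = k"
  shows "tab_content T k = int (snd p) - int (fst p)"
proof -
  have "(THE p. T p = k) = p"
    using assms SYT_inj[OF assms(1,2)] by (intro the_equality) metis+
  thus ?thesis by (simp add: tab_content_def Let_def)
qed

lemma cells_closed:
  assumes "partition_of lam r" "(i, j) \<in> cells lam" "i' \<le> i" "j' \<le> j"
  shows "(i', j') \<in> cells lam"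
proof -
  have "lam ! i \<le> lam ! i'"
    using assms by (cases "i' = i") (auto simp: partition_of_def cells_def sorted_wrt_iff_nth_less)
  thus ?thesis using assms by (auto simp: cells_def)
qed

lemma before_cells:
  assumes "T \<in> SYT lam" "p \<in> cells lam" "p' \<in> cells lam"
    "fst p = fst p' \<and> snd p < snd p' \<or> snd p = snd p' \<and> fst p < fst p'"
  shows "T p < T p'"
  using before_less[OF assms(1), of "T p" "T p'"] assms by (auto simp: before_def)

lemma content_1:
  assumes "partition_of lam r" "T \<in> SYT lam" "1 \<le> r"
  shows "tab_content T 1 = 0"
proof -
  obtain p where p: "p \<in> cells lam" "T p = 1"
    using SYT_cell[OF assms(2), of 1] assms by (auto simp: partition_of_def)
  obtain i j where ij: "p = (i, j)" by force
  have c: "(i, 0) \<in> cells lam" "(0, j) \<in> cells lam"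
    using cells_closed[OF assms(1), of i j] p ij by auto
  have "j = 0" using before_cells[OF assms(2) c(1) p(1)] SYT_range[OF assms(2) c(1)] p ij by force
  moreover have "i = 0" using before_cells[OF assms(2) c(2) p(1)] SYT_range[OF assms(2) c(2)] p ij by force
  ultimately show ?thesis using content_cell[OF assms(2) p] ij by simp
qed

lemma content_distinct:
  assumes "partition_of lam r" "T \<in> SYT lam" "1 \<le> k" "k < l" "l \<le> k + 2" "l \<le> r"
  shows "tab_content T k \<noteq> tab_content T l"
proof
  assume eq: "tab_content T k = tab_content T l"
  have r: "sum_list lam = r" using assms by (simp add: partition_of_def)
  obtain p where p: "p \<in> cells lam" "T p = k" using SYT_cell[OF assms(2), of k] assms r by auto
  obtain p' where p': "p' \<in> cells lam" "T p' = l" using SYT_cell[OF assms(2), of l] assms r by auto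
  obtain i j where ij: "p = (i, j)" by force
  obtain i' j' where ij': "p' = (i', j')" by force
  have d: "int j - int i = int j' - int i'"
    using eq content_cell[OF assms(2) p] content_cell[OF assms(2) p'] ij ij' by simp
  have "i \<noteq> i'" using d p p' ij ij' assms by auto
  moreover have "\<not> i' < i"
  proof
    assume "i' < i"
    hence c: "(i, j') \<in> cells lam" and lt: "j' < j" using cells_closed[OF assms(1), of i j i j'] d p ij by auto
    have "T (i, j') < T p" using before_cells[OF assms(2) c p(1)] ij lt by simp
    moreover have "T p' < T (i, j')" using before_cells[OF assms(2) p'(1) c] ij' \<open>i' < i\<close> by simp
    ultimately show False using assms p p' by simp
  qed
  ultimately have lt: "i < i'" "j < j'" using d by auto
  have c: "(i', j) \<in> cells lam" "(i, j') \<in> cells lam"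
    using cells_closed[OF assms(1), of i' j'] p' ij' lt by auto
  have "T p < T (i', j)" "T p < T (i, j')" "T (i', j) < T p'" "T (i, j') < T p'"
    using before_cells[OF assms(2) p(1) c(1)] before_cells[OF assms(2) p(1) c(2)]
      before_cells[OF assms(2) c(1) p'(1)] before_cells[OF assms(2) c(2) p'(1)] ij ij' lt by auto
  moreover have "T (i', j) \<noteq> T (i, j')" using SYT_inj[OF assms(2) c(1), of "(i, j')"] lt by auto
  ultimately show False using p p' assms by auto
qed

lemma axial_nonzero:
  assumes "partition_of lam r" "T \<in> SYT lam" "1 \<le> i" "i < r"
  shows "axial T i \<noteq> 0"
  using content_distinct[OF assms(1,2), of i "i + 1"] assms by (simp add: axial_def)

lemma before_axial:
  assumes "partition_of lam r" "T \<in> SYT lam" "before lam T i (i + 1)"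
  shows "\<bar>axial T i\<bar> = 1"
proof -
  obtain p p' where p: "p \<in> cells lam" "p' \<in> cells lam" "T p = i" "T p' = i + 1" 
     "fst p = fst p' \<and> snd p < snd p' \<or> snd p = snd p' \<and> fst p < fst p'"
    using assms(3) by (auto simp: before_def)
  have no: False if "c \<in> cells lam" "T p < T c" "T c < T p'" for c
    using that p by simp
  from p(5) show ?thesis
  proof
    assume h: "fst p = fst p' \<and> snd p < snd p'"
    have "snd p' = snd p + 1"
    proof (rule ccontr)
      assume n: "snd p' \<noteq> snd p + 1"
      define c where "c = (fst p, snd p + 1)"
      have c: "c \<in> cells lam"
        using cells_closed[OF assms(1), of "fst p'" "snd p'" "fst p" "snd p + 1"] p h n by (simp add: c_def)
      show False
        using no[OF c] before_cells[OF assms(2) p(1) c] before_cells[OF assms(2) c p(2)] h n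
        by (auto simp: c_def)
    qed
    thus ?thesis using h content_cell[OF assms(2) p(1,3)] content_cell[OF assms(2) p(2,4)]
      by (simp add: axial_def)
  next
    assume h: "snd p = snd p' \<and> fst p < fst p'"
    have "fst p' = fst p + 1"
    proof (rule ccontr)
      assume n: "fst p' \<noteq> fst p + 1"
      define c where "c = (fst p + 1, snd p)"
      have c: "c \<in> cells lam"
        using cells_closed[OF assms(1), of "fst p'" "snd p'" "fst p + 1" "snd p"] p h n by (simp add: c_def)
      show False
        using no[OF c] before_cells[OF assms(2) p(1) c] before_cells[OF assms(2) c p(2)] h n
        by (auto simp: c_def)
    qed
    thus ?thesis using h content_cell[OF assms(2) p(1,3)] content_cell[OF assms(2) p(2,4)]
      by (simp add: axial_def)
  qed
qed

lemma bij_transpose_interval: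
  "1 \<le> (i::nat) \<Longrightarrow> i < r \<Longrightarrow> bij_betw (Transposition.transpose i (i + 1)) {1..r} {1..r}"
  unfolding bij_betw_def by (intro conjI inj_on_transpose transpose_image_eq) auto

lemma tab_swap_SYT:
  assumes "partition_of lam r" "T \<in> SYT lam" "1 \<le> i" "i < r"
  shows "tab_swap i T \<in> SYT lam \<longleftrightarrow> \<not> before lam T i (i + 1)"
proof -
  have r: "sum_list lam = r" using assms by (simp add: partition_of_def)
  have "tab_swap i T \<in> SYT lam \<longleftrightarrow>
    (\<forall>k l. before lam T k l \<longrightarrow> Transposition.transpose i (i + 1) k < Transposition.transpose i (i + 1) l)"
    unfolding tab_swap_def using assms(2)
  proof (rule SYT_perm)
    show "bij_betw (Transposition.transpose i (i + 1)) {1..sum_list lam} {1..sum_list lam}"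
      using bij_transpose_interval assms r by simp
    show "Transposition.transpose i (i + 1) 0 = 0" using assms by (simp add: transpose_def)
  qed
  also have "\<dots> \<longleftrightarrow> \<not> before lam T i (i + 1)"
  proof safe
    fix k l
    assume nb: "\<not> before lam T i (i + 1)" and b: "before lam T k l"
    have "k < l" using before_less[OF assms(2) b] .
    moreover have "\<not> (k = i \<and> l = i + 1)" using nb b by auto
    ultimately show "Transposition.transpose i (i + 1) k < Transposition.transpose i (i + 1) l"
      by (auto simp: transpose_def)
  next
    assume "\<forall>k l. before lam T k l \<longrightarrow>
      Transposition.transpose i (i + 1) k < Transposition.transpose i (i + 1) l"
      and "before lam T i (i + 1)"
    hence "Transposition.transpose i (i + 1) i < Transposition.transpose i (i + 1) (i + 1)" by blast
    thus False by simp
  qed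
  finally show ?thesis .
qed

lemma tab_swap_before:
  "before lam (tab_swap i T) k l \<longleftrightarrow>
     before lam T (Transposition.transpose i (i + 1) k) (Transposition.transpose i (i + 1) l)"
  unfolding tab_swap_def before_comp by (metis transpose_involutory)

lemma tab_swap_swap [simp]: "tab_swap i (tab_swap i T) = T"
  by (simp add: tab_swap_def flip: comp_assoc)

lemma content_tab_swap:
  "tab_content (tab_swap i T) k = tab_content T (Transposition.transpose i (i + 1) k)"
proof -
  have "(\<lambda>p. tab_swap i T p = k) = (\<lambda>p. T p = Transposition.transpose i (i + 1) k)"
    by (auto simp: tab_swap_def fun_eq_iff)
  thus ?thesis by (simp add: tab_content_def)
qed


subsection \<open>The representation space\<close>

lemma vector_space_vscale: "vector_space vscale"
  by unfold_locales (simp_all add: vscale_def fun_eq_iff algebra_simps)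

lemma linear_vscale_iff:
  "Vector_Spaces.linear vscale vscale f \<longleftrightarrow>
     (\<forall>v w. f (v + w) = f v + f w) \<and> (\<forall>c v. f (c \<odot> v) = c \<odot> f v)"
  using vector_space_vscale by (simp add: Vector_Spaces.linear_iff)

lemma vscale_apply [simp]: "(c \<odot> v) S = c * v S"
  by (simp add: vscale_def)

lemma sum_vec_apply: "(\<Sum>T\<in>A. f T) S = (\<Sum>T\<in>A. f T (S :: tableau) :: ratfun)"
  by (induction A rule: infinite_finite_induct) auto

lemma lin_ext_apply: "lin_ext lam f v S = (\<Sum>T\<in>SYT lam. v T * f T S)"
  by (simp add: lin_ext_def sum_vec_apply)

lemma linear_lin_ext: "Vector_Spaces.linear vscale vscale (lin_ext lam f)"
  by (simp add: linear_vscale_iff fun_eq_iff lin_ext_apply sum.distrib sum_distrib_left algebra_simps)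

lemma lin_ext_basis:
  assumes "T \<in> SYT lam"
  shows "lin_ext lam f (basis T) = f T"
proof
  fix S
  have "lin_ext lam f (basis T) S = (\<Sum>T'\<in>SYT lam. if T' = T then f T S else 0)"
    unfolding lin_ext_apply basis_def by (intro sum.cong) auto
  thus "lin_ext lam f (basis T) S = f T S" using assms by simp
qed

lemma basis_expansion:
  assumes "v \<in> seminormal_space lam"
  shows "v = lin_ext lam basis v"
proof
  fix S
  have "lin_ext lam basis v S = (\<Sum>T\<in>SYT lam. if S = T then v S else 0)"
    unfolding lin_ext_apply basis_def by (intro sum.cong) auto
  also have "\<dots> = v S" using assms by (simp add: seminormal_space_def)
  finally show "v S = lin_ext lam basis v S" by simp
qed

lemma linear_sum_vscale:
  assumes "Vector_Spaces.linear vscale vscale f" "finite A"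
  shows "f (\<Sum>T\<in>A. c T \<odot> g T) = (\<Sum>T\<in>A. c T \<odot> f (g T))"
  using assms(2)
proof induction
  case empty
  have "f (0 \<odot> 0) = 0 \<odot> f 0" using assms(1) unfolding linear_vscale_iff by blast
  moreover have "0 \<odot> w = 0" for w by (simp add: fun_eq_iff)
  ultimately have "f 0 = 0" by simp
  thus ?case by (simp only: sum.empty)
next
  case (insert x F)
  have "(\<Sum>T\<in>insert x F. c T \<odot> h T) = c x \<odot> h x + (\<Sum>T\<in>F. c T \<odot> h T)" for h
    by (rule sum.insert[OF insert.hyps])
  moreover have "f (c x \<odot> g x + w) = c x \<odot> f (g x) + f w" for w
    using assms(1) unfolding linear_vscale_iff by metis
  ultimately show ?case by (simp only: insert.IH)
qed

lemma linear_eq_on_space: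
  assumes "Vector_Spaces.linear vscale vscale f" "Vector_Spaces.linear vscale vscale g"
    and eq: "\<And>T. T \<in> SYT lam \<Longrightarrow> f (basis T) = g (basis T)"
    and v: "v \<in> seminormal_space lam"
  shows "f v = g v"
proof -
  have "f (lin_ext lam basis v) = g (lin_ext lam basis v)"
    unfolding lin_ext_def
    by (simp add: linear_sum_vscale[OF assms(1)] linear_sum_vscale[OF assms(2)] eq)
  thus ?thesis using basis_expansion[OF v] by simp
qed

lemma basis_in_space: "T \<in> SYT lam \<Longrightarrow> basis T \<in> seminormal_space lam"
  by (auto simp: seminormal_space_def basis_def)

lemma subspace_seminormal_space: "module.subspace vscale (seminormal_space lam)"
proof -
  interpret vector_space vscale by (rule vector_space_vscale)
  show ?thesis by (auto simp: subspace_def seminormal_space_def)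
qed

lemma lin_ext_in_space:
  assumes "\<And>T. T \<in> SYT lam \<Longrightarrow> f T \<in> seminormal_space lam"
  shows "lin_ext lam f v \<in> seminormal_space lam"
  using assms by (auto simp: seminormal_space_def lin_ext_apply intro!: sum.neutral)

subsection \<open>The Hecke relations\<close>

definition basis0 :: "nat list \<Rightarrow> tableau \<Rightarrow> vec" where
  "basis0 lam T = (if T \<in> SYT lam then basis T else 0)"

lemma linear_u_op: "Vector_Spaces.linear vscale vscale (u_op lam i)"
  unfolding u_op_def by (rule linear_lin_ext)

lemma u_op_add: "u_op lam i (v + w) = u_op lam i v + u_op lam i w"
  and u_op_scale: "u_op lam i (c \<odot> v) = c \<odot> u_op lam i v"
  using linear_u_op unfolding linear_vscale_iff by blast+

lemma u_op_0: "u_op lam i 0 = 0"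
  by (simp add: u_op_def fun_eq_iff lin_ext_apply)

lemma u_op_basis:
  assumes "T \<in> SYT lam"
  shows "u_op lam i (basis T) =
    dcoef (axial T i) \<odot> basis T + ecoef (axial T i) \<odot> basis0 lam (tab_swap i T)"
  unfolding u_op_def lin_ext_basis[OF assms]
  by (auto simp: Let_def dcoef_def ecoef_def axial_def s_act_def basis0_def fun_eq_iff)

lemma u_op_in_space: "u_op lam i v \<in> seminormal_space lam"
  unfolding u_op_def
proof (rule lin_ext_in_space)
  fix T assume T: "T \<in> SYT lam"
  show "(let a = axial T i in
     if tab_content T (i + 1) > tab_content T i
     then - (qint (a - 1) / qint a) \<odot> basis T + s_act lam i T
     else - (qint (a - 1) / qint a) \<odot> basis T
            + (qint (a - 1) * qint (a + 1) / (qint a)\<^sup>2) \<odot> s_act lam i T) \<in> seminormal_space lam"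
    using T by (auto simp: Let_def s_act_def seminormal_space_def basis_def)
qed

lemma u_op_basis0:
  assumes "T \<in> SYT lam \<or> tab_swap i T \<notin> SYT lam"
  shows "u_op lam i (basis0 lam T) =
    dcoef (axial T i) \<odot> basis0 lam T + ecoef (axial T i) \<odot> basis0 lam (tab_swap i T)"
proof (cases "T \<in> SYT lam")
  case True
  then show ?thesis using u_op_basis[of T lam i] by (simp add: basis0_def)
next
  case False
  then show ?thesis using assms by (simp add: basis0_def u_op_0 fun_eq_iff)
qed

lemma axial_tab_swap: "axial (tab_swap i T) i = - axial T i"
  by (simp add: axial_def content_tab_swap)

lemma u_op_back:
  assumes "partition_of lam r" "T \<in> SYT lam" "1 \<le> i" "i < r"
  defines "a \<equiv> axial T i"
  shows "ecoef a * u_op lam i (basis0 lam (tab_swap i T)) S =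
    ecoef a * (dcoef (- a) * basis0 lam (tab_swap i T) S + ecoef (- a) * basis0 lam T S)"
proof (cases "tab_swap i T \<in> SYT lam")
  case True
  then show ?thesis using u_op_basis0[of "tab_swap i T" lam i]
    by (simp add: axial_tab_swap a_def)
next
  case False
  hence "before lam T i (i + 1)" using tab_swap_SYT[OF assms(1-4)] by simp
  hence "ecoef a * ecoef (- a) = 0"
    using before_axial[OF assms(1,2)] ecoef_prod_1 by (simp add: a_def)
  hence "ecoef a * (ecoef (- a) * basis0 lam T S) = 0" by (simp flip: mult.assoc)
  then show ?thesis using False by (simp add: basis0_def u_op_0)
qed

lemma quadratic_identity:
  fixes d d' e e' w x y z :: "'a :: idom"
  assumes "e * y = e * (d' * z + e' * x)" "e * e' = d * d'" "d + d' = - w"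
  shows "d * (d * x + e * z) + e * y = - w * (d * x + e * z)"
  using assms by algebra

lemma braid_identity:
  fixes da da' db db' dab ea ea' eb eb' eab x0 x1 x2 x12 x21 x121 y z :: "'a :: idom"
  assumes "ea * y = ea * (da' * x1 + ea' * x0)" "eb * z = eb * (db' * x2 + eb' * x0)"
    and "ea * ea' = da * da'" "eb * eb' = db * db'"
    and "da * db + dab * da' - 1 = db * dab" "db * da + dab * db' - 1 = da * dab"
  shows "da * (db * (da * x0 + ea * x1) + eb * (dab * x2 + eab * x12))
      + ea * (dab * y + eab * (db * x21 + eb * x121)) - (da * x0 + ea * x1)
    = db * (da * (db * x0 + eb * x2) + ea * (dab * x1 + eab * x21))
      + eb * (dab * z + eab * (da * x12 + ea * x121)) - (db * x0 + eb * x2)"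
proof -
  have "da * (db * (da * x0 + ea * x1) + eb * (dab * x2 + eab * x12))
      + ea * (dab * y + eab * (db * x21 + eb * x121)) - (da * x0 + ea * x1)
    = da * (da * db + dab * da' - 1) * x0 + ea * (da * db + dab * da' - 1) * x1 + da * eb * dab * x2
      + da * eb * eab * x12 + ea * eab * db * x21 + ea * eab * eb * x121"
    using assms(1,3) by algebra
  moreover have "db * (da * (db * x0 + eb * x2) + ea * (dab * x1 + eab * x21))
      + eb * (dab * z + eab * (da * x12 + ea * x121)) - (db * x0 + eb * x2)
    = db * (db * da + dab * db' - 1) * x0 + eb * (db * da + dab * db' - 1) * x2 + db * ea * dab * x1
      + da * eb * eab * x12 + ea * eab * db * x21 + ea * eab * eb * x121"
    using assms(2,4) by algebra
  ultimately show ?thesis unfolding assms(5,6) by algebra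
qed

lemma u_op_quadratic:
  assumes "partition_of lam r" "T \<in> SYT lam" "1 \<le> i" "i < r"
  shows "u_op lam i (u_op lam i (basis T)) = - qint 2 \<odot> u_op lam i (basis T)"
proof
  fix S
  define a where "a = axial T i"
  have a: "a \<noteq> 0" using axial_nonzero[OF assms] by (simp add: a_def)
  have b: "basis T = basis0 lam T" using assms by (simp add: basis0_def)
  have u: "u_op lam i (basis0 lam T) = dcoef a \<odot> basis0 lam T + ecoef a \<odot> basis0 lam (tab_swap i T)"
    using u_op_basis0[of T lam i] assms by (simp add: a_def)
  show "u_op lam i (u_op lam i (basis T)) S = (- qint 2 \<odot> u_op lam i (basis T)) S"
    using quadratic_identity[OF u_op_back[OF assms, of S, folded a_def] ecoef_prod[OF a] dcoef_sum[OF a]]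
    unfolding b by (simp add: u u_op_add u_op_scale del: mult_minus_left)
qed

lemma tab_swap_braid:
  "tab_swap i (tab_swap (i + 1) (tab_swap i T)) = tab_swap (i + 1) (tab_swap i (tab_swap (i + 1) T))"
  by (auto simp: tab_swap_def fun_eq_iff transpose_def)

lemma tab_swap_commute:
  "i + 1 < j \<Longrightarrow> tab_swap i (tab_swap j T) = tab_swap j (tab_swap i T)"
  by (auto simp: tab_swap_def fun_eq_iff transpose_def)

lemma not_SYT: "before lam T k l \<Longrightarrow> l \<le> k \<Longrightarrow> T \<notin> SYT lam"
  using before_less by fastforce

lemma u_op_braid:
  assumes "partition_of lam r" "T \<in> SYT lam" "1 \<le> i" "i + 1 < r"
  shows "u_op lam i (u_op lam (i + 1) (u_op lam i (basis T))) - u_op lam i (basis T) =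
    u_op lam (i + 1) (u_op lam i (u_op lam (i + 1) (basis T))) - u_op lam (i + 1) (basis T)"
proof
  fix S
  define j where "j = i + 1"
  define a b where "a = axial T i" and "b = axial T j"
  have i: "1 \<le> i" "i < r" and j: "1 \<le> j" "j < r" using assms by (auto simp: j_def)
  have a: "a \<noteq> 0" and b: "b \<noteq> 0"
    using axial_nonzero[OF assms(1,2)] i j by (auto simp: a_def b_def)
  have ab: "a + b \<noteq> 0"
    using content_distinct[OF assms(1,2), of i "i + 2"] assms by (simp add: a_def b_def j_def axial_def)
  define T1 T2 T12 T21 T121 where "T1 = tab_swap i T" and "T2 = tab_swap j T"
    and "T12 = tab_swap i T2" and "T21 = tab_swap j T1" and "T121 = tab_swap i T21"
  have T121: "T121 = tab_swap j T12"
    using tab_swap_braid[of i T] by (simp add: T121_def T12_def T21_def T1_def T2_def j_def)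
  note defs = T1_def T2_def T12_def T21_def T121_def j_def
  have T1: "T1 \<notin> SYT lam \<longleftrightarrow> before lam T i (i + 1)"
    using tab_swap_SYT[OF assms(1,2) i] by (simp add: T1_def)
  have T2: "T2 \<notin> SYT lam \<longleftrightarrow> before lam T (i + 1) (i + 2)"
    using tab_swap_SYT[OF assms(1,2) j] by (simp add: T2_def j_def)
  have T21: "T21 \<notin> SYT lam" if "T1 \<notin> SYT lam"
    using that unfolding T1
    by (intro not_SYT[of lam _ "i + 2" i]) (simp_all add: defs tab_swap_before transpose_def)
  have T12: "T12 \<notin> SYT lam" if "T2 \<notin> SYT lam"
    using that unfolding T2
    by (intro not_SYT[of lam _ "i + 2" i]) (simp_all add: defs tab_swap_before transpose_def)
  have T121': "T121 \<notin> SYT lam" if "T21 \<notin> SYT lam"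
  proof (cases "T1 \<in> SYT lam")
    case True
    hence "before lam T1 j (j + 1)"
      using that tab_swap_SYT[OF assms(1) True j] by (simp add: T21_def)
    thus ?thesis
      by (intro not_SYT[of lam _ "i + 2" i]) (simp_all add: defs tab_swap_before transpose_def)
  next
    case False
    thus ?thesis unfolding T1
      by (intro not_SYT[of lam _ "i + 2" "i + 1"]) (simp_all add: defs tab_swap_before transpose_def)
  qed
  have T121'': "T121 \<notin> SYT lam" if "T12 \<notin> SYT lam"
  proof (cases "T2 \<in> SYT lam")
    case True
    hence "before lam T2 i (i + 1)"
      using that tab_swap_SYT[OF assms(1) True i] by (simp add: T12_def)
    thus ?thesis
      by (intro not_SYT[of lam _ "i + 2" i]) (simp_all add: defs tab_swap_before transpose_def)
  next
    case False
    thus ?thesis unfolding T2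
      by (intro not_SYT[of lam _ "i + 1" "i"]) (simp_all add: defs tab_swap_before transpose_def)
  qed
  let ?D = "basis0 lam"
  have ax: "axial T1 j = a + b" "axial T2 i = a + b" "axial T21 i = b" "axial T12 j = a"
    by (simp_all add: defs a_def b_def axial_def content_tab_swap transpose_def)
  have U0: "u_op lam i (?D T) = dcoef a \<odot> ?D T + ecoef a \<odot> ?D T1"
    using u_op_basis0[of T lam i] assms(2) by (simp add: a_def T1_def)
  have W0: "u_op lam j (?D T) = dcoef b \<odot> ?D T + ecoef b \<odot> ?D T2"
    using u_op_basis0[of T lam j] assms(2) by (simp add: b_def T2_def)
  have W1: "u_op lam j (?D T1) = dcoef (a + b) \<odot> ?D T1 + ecoef (a + b) \<odot> ?D T21"
    using u_op_basis0[of T1 lam j] T21 unfolding ax T21_def by blast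
  have U2: "u_op lam i (?D T2) = dcoef (a + b) \<odot> ?D T2 + ecoef (a + b) \<odot> ?D T12"
    using u_op_basis0[of T2 lam i] T12 unfolding ax T12_def by blast
  have U21: "u_op lam i (?D T21) = dcoef b \<odot> ?D T21 + ecoef b \<odot> ?D T121"
    using u_op_basis0[of T21 lam i] T121' unfolding ax T121_def by blast
  have W12: "u_op lam j (?D T12) = dcoef a \<odot> ?D T12 + ecoef a \<odot> ?D T121"
    using u_op_basis0[of T12 lam j] T121'' unfolding ax T121 by blast
  have br: "dcoef b * dcoef a + dcoef (a + b) * dcoef (- b) - 1 = dcoef a * dcoef (a + b)"
    using dcoef_braid[OF b a] ab by (simp add: add.commute)
  have bT: "basis T = ?D T" using assms(2) by (simp add: basis0_def)
  have L: "(u_op lam i (u_op lam j (u_op lam i (basis T))) - u_op lam i (basis T)) S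
    = dcoef a * (dcoef b * (dcoef a * ?D T S + ecoef a * ?D T1 S)
        + ecoef b * (dcoef (a + b) * ?D T2 S + ecoef (a + b) * ?D T12 S))
      + ecoef a * (dcoef (a + b) * u_op lam i (?D T1) S
        + ecoef (a + b) * (dcoef b * ?D T21 S + ecoef b * ?D T121 S))
      - (dcoef a * ?D T S + ecoef a * ?D T1 S)"
    unfolding bT by (simp only: U0 W0 W1 U2 U21 u_op_add u_op_scale vscale_apply plus_fun_apply minus_apply)
  have R: "(u_op lam j (u_op lam i (u_op lam j (basis T))) - u_op lam j (basis T)) S
    = dcoef b * (dcoef a * (dcoef b * ?D T S + ecoef b * ?D T2 S)
        + ecoef a * (dcoef (a + b) * ?D T1 S + ecoef (a + b) * ?D T21 S))
      + ecoef b * (dcoef (a + b) * u_op lam j (?D T2) S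
        + ecoef (a + b) * (dcoef a * ?D T12 S + ecoef a * ?D T121 S))
      - (dcoef b * ?D T S + ecoef b * ?D T2 S)"
    unfolding bT by (simp only: U0 W0 W1 U2 W12 u_op_add u_op_scale vscale_apply plus_fun_apply minus_apply)
  have "(u_op lam i (u_op lam j (u_op lam i (basis T))) - u_op lam i (basis T)) S
    = (u_op lam j (u_op lam i (u_op lam j (basis T))) - u_op lam j (basis T)) S"
    unfolding L R
    by (rule braid_identity[OF u_op_back[OF assms(1,2) i, of S, folded a_def T1_def]
        u_op_back[OF assms(1,2) j, of S, folded b_def T2_def]
        ecoef_prod[OF a] ecoef_prod[OF b] dcoef_braid[OF a b ab] br])
  thus "(u_op lam i (u_op lam (i + 1) (u_op lam i (basis T))) - u_op lam i (basis T)) S =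
    (u_op lam (i + 1) (u_op lam i (u_op lam (i + 1) (basis T))) - u_op lam (i + 1) (basis T)) S"
    by (simp only: j_def)
qed

lemma u_op_commute:
  assumes "partition_of lam r" "T \<in> SYT lam" "1 \<le> i" "i + 1 < j" "j < r"
  shows "u_op lam i (u_op lam j (basis T)) = u_op lam j (u_op lam i (basis T))"
proof -
  define a b where "a = axial T i" and "b = axial T j"
  define T1 T2 T12 where "T1 = tab_swap i T" and "T2 = tab_swap j T" and "T12 = tab_swap i T2"
  have T12: "T12 = tab_swap j T1"
    using tab_swap_commute[of i j T] assms by (simp add: T12_def T1_def T2_def)
  have 1: "T12 \<notin> SYT lam" if "T1 \<notin> SYT lam"
  proof -
    have "before lam T i (i + 1)" using that tab_swap_SYT[OF assms(1,2), of i] assms by (simp add: T1_def)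
    thus ?thesis using assms
      by (intro not_SYT[of lam _ "i + 1" i]) (simp_all add: T12 T1_def tab_swap_before transpose_def)
  qed
  have 2: "T12 \<notin> SYT lam" if "T2 \<notin> SYT lam"
  proof -
    have "before lam T j (j + 1)" using that tab_swap_SYT[OF assms(1,2), of j] assms by (simp add: T2_def)
    thus ?thesis using assms
      by (intro not_SYT[of lam _ "j + 1" j]) (simp_all add: T12_def T2_def tab_swap_before transpose_def)
  qed
  have ax: "axial T1 j = b" "axial T2 i = a"
    using assms by (simp_all add: T1_def T2_def a_def b_def axial_def content_tab_swap transpose_def)
  let ?D = "basis0 lam"
  have U0: "u_op lam i (?D T) = dcoef a \<odot> ?D T + ecoef a \<odot> ?D T1"
    using u_op_basis0[of T lam i] assms(2) by (simp add: a_def T1_def)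
  have W0: "u_op lam j (?D T) = dcoef b \<odot> ?D T + ecoef b \<odot> ?D T2"
    using u_op_basis0[of T lam j] assms(2) by (simp add: b_def T2_def)
  have W1: "u_op lam j (?D T1) = dcoef b \<odot> ?D T1 + ecoef b \<odot> ?D T12"
    using u_op_basis0[of T1 lam j] 1 unfolding ax T12 by blast
  have U2: "u_op lam i (?D T2) = dcoef a \<odot> ?D T2 + ecoef a \<odot> ?D T12"
    using u_op_basis0[of T2 lam i] 2 unfolding ax T12_def by blast
  have bT: "basis T = ?D T" using assms(2) by (simp add: basis0_def)
  show ?thesis unfolding bT
    by (simp add: U0 W0 W1 U2 u_op_add u_op_scale fun_eq_iff algebra_simps)
qed

lemma linear_comp:
  "Vector_Spaces.linear vscale vscale f \<Longrightarrow> Vector_Spaces.linear vscale vscale g \<Longrightarrow>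
   Vector_Spaces.linear vscale vscale (\<lambda>v. f (g v))"
  by (simp add: linear_vscale_iff)

lemma linear_diff:
  "Vector_Spaces.linear vscale vscale f \<Longrightarrow> Vector_Spaces.linear vscale vscale g \<Longrightarrow>
   Vector_Spaces.linear vscale vscale (\<lambda>v. f v - g v)"
  by (simp add: linear_vscale_iff fun_eq_iff algebra_simps)

lemma linear_vscale:
  "Vector_Spaces.linear vscale vscale f \<Longrightarrow> Vector_Spaces.linear vscale vscale (\<lambda>v. c \<odot> f v)"
  by (simp add: linear_vscale_iff fun_eq_iff algebra_simps)

theorem hecke_rep_seminormal:
  assumes "partition_of lam r"
  shows "hecke_rep r (seminormal_space lam) (u_op lam)"
  unfolding hecke_rep_def
proof (intro conjI ballI allI impI)
  show "module.subspace vscale (seminormal_space lam)" by (rule subspace_seminormal_space)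
next
  fix i
  show "Vector_Spaces.linear vscale vscale (u_op lam i)" by (rule linear_u_op)
  show "u_op lam i ` seminormal_space lam \<subseteq> seminormal_space lam" using u_op_in_space by blast
next
  fix i v assume i: "i \<in> {1..<r}" and v: "v \<in> seminormal_space lam"
  show "u_op lam i (u_op lam i v) = - qint 2 \<odot> u_op lam i v"
    by (rule linear_eq_on_space[OF linear_comp[OF linear_u_op linear_u_op]
          linear_vscale[OF linear_u_op] _ v])
      (use i u_op_quadratic[OF assms] in simp)
next
  fix i v assume i: "1 \<le> i \<and> i + 1 < r" and v: "v \<in> seminormal_space lam"
  note lin3 = linear_comp[OF linear_u_op linear_comp[OF linear_u_op linear_u_op]]
  show "u_op lam i (u_op lam (i + 1) (u_op lam i v)) - u_op lam i v =
    u_op lam (i + 1) (u_op lam i (u_op lam (i + 1) v)) - u_op lam (i + 1) v"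
    by (rule linear_eq_on_space[OF linear_diff[OF lin3 linear_u_op]
          linear_diff[OF lin3 linear_u_op] _ v])
      (use i u_op_braid[OF assms] in blast)
next
  fix i j v assume ij: "i \<in> {1..<r}" "j \<in> {1..<r}" "i + 1 < j \<or> j + 1 < i"
    and v: "v \<in> seminormal_space lam"
  have "u_op lam i (u_op lam j (basis T)) = u_op lam j (u_op lam i (basis T))" if "T \<in> SYT lam" for T
    using ij u_op_commute[OF assms that, of i j] u_op_commute[OF assms that, of j i] by auto
  thus "u_op lam i (u_op lam j v) = u_op lam j (u_op lam i v)"
    by (rule linear_eq_on_space[OF linear_comp[OF linear_u_op linear_u_op]
          linear_comp[OF linear_u_op linear_u_op] _ v])
qed

subsection \<open>The Jucys--Murphy elements\<close>

definition fcoef :: "int \<Rightarrow> ratfun" where "fcoef a = q + dcoef a"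

lemma fcoef_id:
  fixes p z :: "'a::field"
  assumes "p * p \<noteq> 1" "z \<noteq> 0"
  shows "z + (z * z - p * p) / (z * (p * p - 1)) = p / ((p * p - 1) / (p * (z - inverse z)))"
proof -
  define x z' where "x = inverse (p * p - 1)" and "z' = inverse z"
  have e: "x * (p * p - 1) = 1" "z' * z = 1"
    using assms by (simp_all add: x_def z'_def)
  have "z + (z * z - p * p) * (z' * x) = p * ((p * (z - z')) * x)"
    using e by algebra
  thus ?thesis
    by (simp add: divide_inverse mult_ac flip: x_def z'_def)
qed

lemma fcoef:
  assumes "a \<noteq> 0"
  shows "fcoef a = q powi a / qint a"
proof -
  have "Q a \<noteq> 1" using assms by (simp add: Q_eq_1)
  thus ?thesis
    using fcoef_id[of "q powi a" q] assms by (simp add: fcoef_def dcoef_Q qint_Q Q_def)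
qed

lemma linear_t_op: "Vector_Spaces.linear vscale vscale (t_op lam i)"
  by (auto simp: t_op_def linear_vscale_iff u_op_add u_op_scale fun_eq_iff algebra_simps)

lemma JM_Suc: "JM lam (Suc i) = t_op lam (Suc i) \<circ> JM lam i \<circ> t_op lam (Suc i)"
  by (simp add: JM_def comp_assoc)

lemma JM_0: "JM lam 0 = id"
  by (simp add: JM_def)

lemma linear_JM: "Vector_Spaces.linear vscale vscale (JM lam i)"
proof (induction i)
  case (Suc i)
  show ?case
    unfolding JM_Suc o_def by (rule linear_comp[OF linear_t_op linear_comp[OF Suc linear_t_op]])
next
  case 0
  show ?case unfolding JM_0 id_def linear_vscale_iff by simp
qed

lemma JM_identity:
  fixes f f' d d' e e' c c' x y z k :: "'a :: idom"
  assumes "e * y = e * (f' * z + e' * x)" "e * e' = d * d'"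
    and "c * f + c' * f' = 0" "d * d' = 1 + f * f'" 
  shows "c * f * (f * x + e * z) + c' * (e * y) = c' * x"
  using assms by algebra

theorem JM_basis:
  assumes "partition_of lam r" "T \<in> SYT lam" "i < r"
  shows "JM lam i (basis T) = q powi (2 * tab_content T (i + 1)) \<odot> basis T"
  using assms(2,3)
proof (induction i arbitrary: T)
  case 0
  thus ?case using content_1[OF assms(1), of T] by (simp add: JM_0 fun_eq_iff)
next
  case (Suc i T)
  define n where "n = Suc i"
  define a where "a = axial T n"
  define T1 where "T1 = tab_swap n T"
  have n: "1 \<le> n" "n < r" using Suc.prems by (auto simp: n_def)
  have a: "a \<noteq> 0" using axial_nonzero[OF assms(1) Suc.prems(1) n] by (simp add: a_def)
  define c c' where "c = Q (tab_content T n)" and "c' = Q (tab_content T (n + 1))"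
  have qQ: "q powi (2 * m) = Q m" for m by (simp add: Q_def flip: power_int_add)
  let ?D = "basis0 lam"
  have bT: "basis T = ?D T" using Suc.prems by (simp add: basis0_def)
  have t0: "t_op lam n (?D T) = fcoef a \<odot> ?D T + ecoef a \<odot> ?D T1"
    using u_op_basis0[of T lam n] Suc.prems
    by (simp add: t_op_def fcoef_def a_def T1_def fun_eq_iff algebra_simps)
  have J0: "JM lam i (?D T) = c \<odot> ?D T"
    using Suc.IH[OF Suc.prems(1) Suc_lessD[OF Suc.prems(2)]]
    unfolding bT qQ c_def n_def Suc_eq_plus1 .
  have J1: "JM lam i (?D T1) = c' \<odot> ?D T1"
  proof (cases "T1 \<in> SYT lam")
    case True
    have "tab_content T1 (i + 1) = tab_content T (n + 1)"
      by (simp add: T1_def n_def content_tab_swap)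
    moreover have "basis T1 = ?D T1" using True by (simp add: basis0_def)
    ultimately show ?thesis using Suc.IH[OF True Suc_lessD[OF Suc.prems(2)]]
      unfolding qQ c'_def by metis
  next
    case False
    have "JM lam i 0 = 0"
    proof -
      have "JM lam i (0 \<odot> 0) = 0 \<odot> JM lam i 0" using linear_JM unfolding linear_vscale_iff by blast
      moreover have "0 \<odot> w = 0" for w by (simp add: fun_eq_iff)
      ultimately show ?thesis by simp
    qed
    moreover have "?D T1 = 0" using False by (simp add: basis0_def)
    moreover have "c' \<odot> 0 = 0" by (simp add: fun_eq_iff)
    ultimately show ?thesis by metis
  qed
  have cc: "c' = c * Q a" by (simp add: c_def c'_def a_def axial_def flip: Q_add)
  have "fcoef (- a) = - (inverse (q powi a) / qint a)"
    using a by (simp add: fcoef qint_minus power_int_minus)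
  hence cf: "c * fcoef a + c' * fcoef (- a) = 0"
    using a unfolding cc by (simp add: fcoef Q_def)
  have "qint 2 = q + inverse q"
  proof -
    have "(q + inverse q) * (q - inverse q) = q powi 2 - q powi (- 2)"
      by (simp add: power_int_minus power2_eq_square algebra_simps)
    thus ?thesis using q_minus_inv unfolding qint_def by (metis nonzero_mult_div_cancel_right)
  qed
  hence "dcoef a + dcoef (- a) = - (q + inverse q)" using dcoef_sum[OF a] by simp
  moreover have "q * inverse q = 1" by simp
  ultimately have dd: "dcoef a * dcoef (- a) = 1 + fcoef a * fcoef (- a)"
    unfolding fcoef_def by algebra
  have tback: "ecoef a * t_op lam n (?D T1) S = ecoef a * (fcoef (- a) * ?D T1 S + ecoef (- a) * ?D T S)" for S
    using u_op_back[OF assms(1) Suc.prems(1) n, of S]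
    by (simp add: t_op_def fcoef_def a_def T1_def algebra_simps)
  have "JM lam n (?D T) S = c' * ?D T S" for S
  proof -
    have "JM lam n (?D T) = (c * fcoef a) \<odot> t_op lam n (?D T) + (c' * ecoef a) \<odot> t_op lam n (?D T1)"
    proof -
      have J: "JM lam i (v + w) = JM lam i v + JM lam i w" "JM lam i (k \<odot> v) = k \<odot> JM lam i v" for v w k
        using linear_JM[of lam i] unfolding linear_vscale_iff by blast+
      have t: "t_op lam n (v + w) = t_op lam n v + t_op lam n w" "t_op lam n (k \<odot> v) = k \<odot> t_op lam n v" for v w k
        using linear_t_op[of lam n] unfolding linear_vscale_iff by blast+
      have s: "k \<odot> l \<odot> v = (l * k) \<odot> v" for k l v by (simp add: fun_eq_iff)
      have "JM lam n (?D T) = t_op lam n (JM lam i (t_op lam n (?D T)))"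
        by (simp add: n_def JM_Suc)
      also have "\<dots> = t_op lam n (fcoef a \<odot> c \<odot> ?D T + ecoef a \<odot> c' \<odot> ?D T1)"
        by (simp only: t0 J J0 J1)
      finally show ?thesis by (simp only: t s)
    qed
    hence "JM lam n (?D T) S = c * fcoef a * (fcoef a * ?D T S + ecoef a * ?D T1 S)
        + c' * (ecoef a * t_op lam n (?D T1) S)"
      by (simp add: t0 mult_ac)
    thus ?thesis using JM_identity[OF tback ecoef_prod[OF a] cf dd] by simp
  qed
  thus ?case by (simp add: fun_eq_iff bT qQ c'_def n_def)
qed

lemma vscale_vscale: "k \<odot> l \<odot> v = (k * l) \<odot> v"
  by (simp add: fun_eq_iff)

lemma vscale_one: "1 \<odot> v = v"
  by (simp add: fun_eq_iff)

lemma q_powi_double: "q powi m * q powi m = q powi (2 * m)"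
  by (simp flip: power_int_add)

lemma q_powi_inverse: "q powi m * q powi (- m) = 1"
  by (simp add: power_int_minus)

lemma JM_sqrt_basis:
  assumes "T \<in> SYT lam"
  shows "JM_sqrt lam i (basis T) = q powi (tab_content T (i + 1)) \<odot> basis T"
    and "JM_inv_sqrt lam i (basis T) = q powi (- tab_content T (i + 1)) \<odot> basis T"
  unfolding JM_sqrt_def JM_inv_sqrt_def lin_ext_basis[OF assms] by (rule refl)+

lemma linear_JM_sqrt:
  "Vector_Spaces.linear vscale vscale (JM_sqrt lam i)"
  "Vector_Spaces.linear vscale vscale (JM_inv_sqrt lam i)"
  by (simp_all only: JM_sqrt_def JM_inv_sqrt_def linear_lin_ext)

lemma linear_id: "Vector_Spaces.linear vscale vscale (\<lambda>v. v)"
  by (simp add: linear_vscale_iff)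

theorem JM_sqrt_squared:
  assumes "partition_of lam r" "i < r" "v \<in> seminormal_space lam"
  shows "JM_sqrt lam i (JM_sqrt lam i v) = JM lam i v"
proof (rule linear_eq_on_space[OF linear_comp[OF linear_JM_sqrt(1) linear_JM_sqrt(1)] linear_JM _ assms(3)])
  fix T assume T: "T \<in> SYT lam"
  have "JM_sqrt lam i (c \<odot> w) = c \<odot> JM_sqrt lam i w" for c w
    using linear_JM_sqrt(1) unfolding linear_vscale_iff by blast
  thus "JM_sqrt lam i (JM_sqrt lam i (basis T)) = JM lam i (basis T)"
    by (simp only: JM_sqrt_basis[OF T] JM_basis[OF assms(1) T assms(2)] vscale_vscale q_powi_double)
qed

theorem JM_sqrt_inverse:
  assumes "v \<in> seminormal_space lam"
  shows "JM_inv_sqrt lam i (JM_sqrt lam i v) = v"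
proof (rule linear_eq_on_space[OF linear_comp[OF linear_JM_sqrt(2) linear_JM_sqrt(1)] linear_id _ assms])
  fix T assume T: "T \<in> SYT lam"
  have "JM_inv_sqrt lam i (c \<odot> w) = c \<odot> JM_inv_sqrt lam i w" for c w
    using linear_JM_sqrt(2) unfolding linear_vscale_iff by blast
  thus "JM_inv_sqrt lam i (JM_sqrt lam i (basis T)) = basis T"
    by (simp only: JM_sqrt_basis[OF T] vscale_vscale q_powi_inverse vscale_one)
qed

end

(* Conjugating t_i = q + u_i by the square roots of the Jucys-Murphy elements only affects
   powers of q. In the basis T, s_i T the diagonal entry of t_i is q^a / [a], and it is multiplied
   by q^(c_T(i) - c_T(i+1)) = q^(-a). The off-diagonal entry is unchanged, because the content of i
   in s_i T is that of i + 1 in T. *)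

theory Submission
  imports Defs
begin

text \<open>The coefficient \<open>ecoef\<close> covers both signs of the axial distance at once, so
  the computation needs no case distinction until the very end.\<close>

lemma t_op_basis:
  assumes "T \<in> SYT lam"
  shows "t_op lam i (basis T) = fcoef (axial T i) \<odot> basis T + ecoef (axial T i) \<odot> s_act lam i T"
  using u_op_basis0[of T lam i] assms
  by (simp add: t_op_def fcoef_def basis0_def s_act_def fun_eq_iff algebra_simps)

lemma JM_sqrt_add: "JM_sqrt lam i (v + w) = JM_sqrt lam i v + JM_sqrt lam i w"
  and JM_sqrt_scale: "JM_sqrt lam i (c \<odot> v) = c \<odot> JM_sqrt lam i v"
  using linear_JM_sqrt(1) unfolding linear_vscale_iff by blast+

lemma t_op_scale: "t_op lam i (c \<odot> v) = c \<odot> t_op lam i v"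
  using linear_t_op unfolding linear_vscale_iff by blast

lemma JM_sqrt_s_act:
  assumes "1 \<le> i"
  shows "JM_sqrt lam (i - 1) (s_act lam i T) = q powi tab_content T (i + 1) \<odot> s_act lam i T"
proof (cases "tab_swap i T \<in> SYT lam")
  case True
  then show ?thesis
    \<comment> \<open>\<open>1 \<le> i\<close> gives \<open>i - 1 + 1 = i\<close> despite truncated
      subtraction, so the operator reads the content of \<open>i\<close> in the swapped
      tableau.\<close>
    using assms by (simp add: s_act_def JM_sqrt_basis content_tab_swap)
next
  case False
  then show ?thesis
    by (simp add: s_act_def JM_sqrt_def lin_ext_apply fun_eq_iff)
qed

lemma tau_basis:
  assumes "partition_of lam r" "1 \<le> i" "i < r" "T \<in> SYT lam"
  shows "tau lam i (basis T) =
    (1 / qint (axial T i)) \<odot> basis T + ecoef (axial T i) \<odot> s_act lam i T"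
proof -
  define a c c' where "a = axial T i" and "c = tab_content T i" and "c' = tab_content T (i + 1)"
  have a: "a \<noteq> 0" using axial_nonzero[OF assms(1,4,2,3)] by (simp add: a_def)
  have c': "c' = c + a" by (simp add: a_def c_def c'_def axial_def)
  have "JM_sqrt lam (i - 1) (basis T) = q powi c \<odot> basis T"
    using assms by (simp add: JM_sqrt_basis c_def)
  \<comment> \<open>The inverse square root acts first; its scalar \<open>q powi (- c')\<close>
    passes through the other two operators by linearity.\<close>
  hence "tau lam i (basis T) =
      q powi (- c') \<odot> (fcoef a \<odot> q powi c \<odot> basis T + ecoef a \<odot> q powi c' \<odot> s_act lam i T)"
    unfolding tau_def o_apply JM_sqrt_basis(2)[OF assms(4)] t_op_scale t_op_basis[OF assms(4)]
      JM_sqrt_scale JM_sqrt_add JM_sqrt_s_act[OF assms(2)]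
    by (simp add: a_def c'_def)
  also have "\<dots> = (q powi (- c') * fcoef a * q powi c) \<odot> basis T
      + (q powi (- c') * q powi c') \<odot> ecoef a \<odot> s_act lam i T"
    by (simp add: fun_eq_iff algebra_simps)
  \<comment> \<open>As \<open>fcoef a = q powi a / qint a\<close> and \<open>c' = c + a\<close>, the
    powers of \<open>q\<close> cancel.\<close>
  also have "q powi (- c') * fcoef a * q powi c = 1 / qint a"
  proof -
    have "q powi (- c') * q powi a * q powi c = 1"
      by (simp add: c' flip: power_int_add)
    thus ?thesis
      using a by (simp add: fcoef)
  qed
  also have "q powi (- c') * q powi c' = 1"
    by (simp add: power_int_minus)
  finally show ?thesis by (simp only: vscale_one a_def)
qed

theorem theorem4p8:
  fixes lam :: "nat list" and r i :: nat and T :: tableau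
  assumes "partition_of lam r"
    and "1 \<le> i" and "i \<le> r - 1"
    and "T \<in> SYT lam"
  shows "tau lam i (basis T) = (let a = axial T i in
    if tab_content T (i + 1) > tab_content T i
    then (1 / qint a) \<odot> basis T + s_act lam i T
    else (1 / qint a) \<odot> basis T
         + (qint (a - 1) * qint (a + 1) / (qint a)\<^sup>2) \<odot> s_act lam i T)"
proof -
  have "i < r" using assms(2,3) by simp
  \<comment> \<open>This matches the case condition of the claim with the one in
    \<open>ecoef\<close>.\<close>
  moreover have "tab_content T (i + 1) > tab_content T i \<longleftrightarrow> axial T i > 0"
    by (simp add: axial_def)
  ultimately show ?thesis
    by (simp add: tau_basis[OF assms(1,2) _ assms(4)] ecoef_def Let_def vscale_one)
qed

end
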